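(* A graph $G$ is full, i.e. satisfies $d(G)=\delta(G)+1$, if and only if $G\in\Theta$.
   Context: The domatic number $d(G)$ is the maximum number of parts in a partition of $V(G)$ into dominating sets (a set $S$ is dominating if every vertex outside $S$ has a neighbor in $S$); $\delta(G)$ is the minimum degree. The family $\Theta$: let $H_1,\dots,H_r$ be graphs such that at least one of them, say $H_i$, has an isolated vertex $v$. Form $G$ from the disjoint union of $H_1,\dots,H_r$ by (i) joining $v$ to precisely one vertex in each $H_j$ with $j\neq i$, and (ii) adding some edges among the vertices of $\bigcup_{t=1}^r V(H_t)\setminus\{v\}$ such that every vertex of $H_t$ has at least one neighbor in $H_{t'}$ for each $1\leq t\neq t'\leq r$. $\Theta$ is the family of all graphs $G$ obtained this way. *)

theory Defs
  imports "Graph_Theory.Pair_Digraph" "HOL-Library.Disjoint_Sets"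
begin

text \<open>Finite simple graphs are \<^const>\<open>pair_graph\<close>s: an undirected edge between \<open>u\<close> and \<open>v\<close> is the
  pair of arcs \<open>(u, v)\<close>, \<open>(v, u)\<close>, so the degree of a vertex is its \<^const>\<open>out_degree\<close>.\<close>

definition dominating_set :: "'a pair_pre_digraph \<Rightarrow> 'a set \<Rightarrow> bool" where
  "dominating_set G S \<longleftrightarrow>
     S \<subseteq> pverts G \<and> (\<forall>x \<in> pverts G - S. \<exists>y \<in> S. (x, y) \<in> parcs G)"

definition domatic_partition :: "'a pair_pre_digraph \<Rightarrow> 'a set set \<Rightarrow> bool" where
  "domatic_partition G P \<longleftrightarrow> partition_on (pverts G) P \<and> (\<forall>S \<in> P. dominating_set G S)"

definition domatic_number :: "'a pair_pre_digraph \<Rightarrow> nat" where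
  "domatic_number G = Max {card P | P. domatic_partition G P}"

definition min_degree :: "'a pair_pre_digraph \<Rightarrow> nat" where
  "min_degree G = Min (out_degree (with_proj G) ` pverts G)"

definition full_graph :: "'a pair_pre_digraph \<Rightarrow> bool" where
  "full_graph G \<longleftrightarrow> domatic_number G = min_degree G + 1"

definition isolated_vertex :: "'a pair_pre_digraph \<Rightarrow> 'a \<Rightarrow> bool" where
  "isolated_vertex G v \<longleftrightarrow> v \<in> pverts G \<and> (\<forall>x \<in> pverts G. (v, x) \<notin> parcs G)"

text \<open>In \<open>Theta_construction r H i v w F G\<close>, \<open>w j\<close> is the one vertex of \<open>H j\<close> that is joined to \<open>v\<close>,
  and \<open>F\<close> consists of the edges added afterwards away from \<open>v\<close>; they may run inside one \<open>H t\<close> or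
  between two of them. Requiring the vertex sets to be disjoint makes the disjoint union of the
  \<open>H t\<close> a plain union.\<close>

definition Theta_construction ::
  "nat \<Rightarrow> (nat \<Rightarrow> 'a pair_pre_digraph) \<Rightarrow> nat \<Rightarrow> 'a \<Rightarrow> (nat \<Rightarrow> 'a) \<Rightarrow> ('a \<times> 'a) set
    \<Rightarrow> 'a pair_pre_digraph \<Rightarrow> bool" where
  "Theta_construction r H i v w F G \<longleftrightarrow>
     (\<forall>t \<in> {1..r}. pair_graph (H t) \<and> pverts (H t) \<noteq> {}) \<and>
     disjoint_family_on (\<lambda>t. pverts (H t)) {1..r} \<and>
     i \<in> {1..r} \<and> isolated_vertex (H i) v \<and>
     (\<forall>j \<in> {1..r} - {i}. w j \<in> pverts (H j)) \<and>
     F \<subseteq> ((\<Union>t \<in> {1..r}. pverts (H t)) - {v}) \<times> ((\<Union>t \<in> {1..r}. pverts (H t)) - {v}) \<and>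
     sym F \<and> irrefl F \<and>
     G = \<lparr> pverts = (\<Union>t \<in> {1..r}. pverts (H t)),
           parcs = (\<Union>t \<in> {1..r}. parcs (H t))
                 \<union> (\<Union>j \<in> {1..r} - {i}. {(v, w j), (w j, v)})
                 \<union> F \<rparr> \<and>
     (\<forall>t \<in> {1..r}. \<forall>t' \<in> {1..r}. t \<noteq> t' \<longrightarrow>
        (\<forall>x \<in> pverts (H t). \<exists>y \<in> pverts (H t'). (x, y) \<in> parcs G))"

definition Theta :: "'a pair_pre_digraph set" where
  "Theta = {G. \<exists>r H i v w F. Theta_construction r H i v w F G}"

end

theory Submission
  imports Defs
begin

text \<open>Every class of a domatic partition meets the closed neighbourhood of every vertex, so there are
  at most \<open>\<delta>(G) + 1\<close> classes. In the case of equality, the closed neighbourhood of a vertex \<open>v\<close> of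
  minimum degree is a transversal of the partition: \<open>v\<close> is isolated in the subgraph induced by its own
  class and has exactly one neighbour in every other class. Conversely, in the construction of \<open>\<Theta>\<close> the
  vertex sets of the \<open>H\<^sub>t\<close> form a domatic partition with \<open>r\<close> classes, and \<open>v\<close> has degree \<open>r - 1\<close>.\<close>

text \<open>Trades arcs for neighbours, so that degrees can be compared with sizes of vertex
  sets.\<close>

lemma out_degree_with_proj:
  "out_degree (with_proj G) x = card (parcs G `` {x})"
proof -
  have "out_arcs (with_proj G) x = Pair x ` (parcs G `` {x})"
    by (auto simp: out_arcs_def)
  then show ?thesis
    by (simp add: out_degree_def card_image inj_on_def)
qed

lemma (in pair_fin_digraph) finite_neighbours: "finite (parcs G `` {x})"
  using pair_finite_arcs by (rule finite_Image)

text \<open>A class that misses \<open>x\<close> dominates it and so contains a neighbour of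
  \<open>x\<close>; disjointness of the classes makes the choice injective. Both the bound on
  \<open>card P\<close> and the analysis of equality rest on this \<open>f\<close>.\<close>

lemma domatic_partition_transversal:
  assumes "domatic_partition G P" and "x \<in> pverts G"
  obtains f where "inj_on f P" and "f ` P \<subseteq> insert x (parcs G `` {x})" and "\<And>S. S \<in> P \<Longrightarrow> f S \<in> S"
proof -
  have part: "partition_on (pverts G) P" and dom: "\<And>S. S \<in> P \<Longrightarrow> dominating_set G S"
    using assms(1) by (auto simp: domatic_partition_def)
  have "\<exists>y. y \<in> S \<and> y \<in> insert x (parcs G `` {x})" if "S \<in> P" for S
    using dom[OF that] assms(2) unfolding dominating_set_def by (cases "x \<in> S") auto
  then obtain f where f: "\<And>S. S \<in> P \<Longrightarrow> f S \<in> S"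
    "\<And>S. S \<in> P \<Longrightarrow> f S \<in> insert x (parcs G `` {x})"
    by metis
  have "inj_on f P"
  proof (rule inj_onI)
    fix S T assume "S \<in> P" "T \<in> P" "f S = f T"
    then show "S = T"
      using f(1)[of S] f(1)[of T] disjointD[OF partition_onD2[OF part], of S T] by auto
  qed
  with f that show thesis by blast
qed

context pair_fin_digraph
begin

lemma card_domatic_partition_le_degree:
  assumes "domatic_partition G P" and "x \<in> pverts G"
  shows "card P \<le> card (parcs G `` {x}) + 1"
proof -
  obtain f where "inj_on f P" "f ` P \<subseteq> insert x (parcs G `` {x})"
    by (rule domatic_partition_transversal[OF assms])
  then have "card P \<le> card (insert x (parcs G `` {x}))"
    using finite_neighbours by (intro card_inj_on_le) auto
  also have "\<dots> \<le> card (parcs G `` {x}) + 1"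
    by (simp add: card_insert_le_m1)
  finally show ?thesis .
qed

lemma min_degree_attained:
  assumes "pverts G \<noteq> {}"
  obtains v where "v \<in> pverts G" and "card (parcs G `` {v}) = min_degree G"
proof -
  have "min_degree G \<in> out_degree (with_proj G) ` pverts G"
    unfolding min_degree_def using assms pair_finite_verts by (intro Min_in) auto
  then show thesis
    using that by (auto simp: out_degree_with_proj)
qed

lemma min_degree_le:
  assumes "v \<in> pverts G"
  shows "min_degree G \<le> card (parcs G `` {v})"
  unfolding min_degree_def using assms pair_finite_verts
  by (intro Min_le) (auto simp: out_degree_with_proj intro!: rev_image_eqI)

lemma card_domatic_partition_le_min_degree:
  assumes "pverts G \<noteq> {}" and "domatic_partition G P"
  shows "card P \<le> min_degree G + 1"
  using min_degree_attained[OF assms(1)] card_domatic_partition_le_degree[OF assms(2)] by metis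

text \<open>The degree bound holds for every domatic partition, so the maximum equals the bound
  exactly when some partition attains it.\<close>

lemma full_graph_iff:
  assumes "pverts G \<noteq> {}"
  shows "full_graph G \<longleftrightarrow> (\<exists>P. domatic_partition G P \<and> card P = min_degree G + 1)"
proof -
  let ?C = "{card P | P. domatic_partition G P}"
  have le: "c \<le> min_degree G + 1" if "c \<in> ?C" for c
    using that card_domatic_partition_le_min_degree[OF assms] by auto
  then have fin: "finite ?C"
    by (intro finite_subset[of ?C "{..min_degree G + 1}"]) auto
  \<comment> \<open>The one-class partition keeps \<open>Max\<close> from being applied to the empty
    set.\<close>
  have "domatic_partition G {pverts G}"
    using assms by (auto simp: domatic_partition_def dominating_set_def partition_on_space)
  then have "?C \<noteq> {}" by blast
  then have "Max ?C = min_degree G + 1 \<longleftrightarrow> min_degree G + 1 \<in> ?C"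
    using Max_eq_iff[OF fin] le by auto
  then show ?thesis
    unfolding full_graph_def domatic_number_def by auto
qed

end

text \<open>The classes outnumber the neighbours of \<open>v\<close> by one, so each contains
  exactly one vertex of the closed neighbourhood of \<open>v\<close>. The induced subgraphs on the
  classes serve as the graphs \<open>H t\<close>.\<close>

lemma (in pair_graph) domatic_partition_card_Suc_degree_imp_Theta:
  assumes "domatic_partition G P" and v: "v \<in> pverts G"
    and card_P: "card P = card (parcs G `` {v}) + 1"
  shows "G \<in> Theta"
proof -
  have part: "partition_on (pverts G) P" and dom: "\<And>S. S \<in> P \<Longrightarrow> dominating_set G S"
    using assms(1) by (auto simp: domatic_partition_def)
  have disj: "S = T" if "S \<in> P" "T \<in> P" "x \<in> S" "x \<in> T" for S T x
    using disjointD[OF partition_onD2[OF part] that(1,2)] that(3,4) by blast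
  have arc_sym: "(y, x) \<in> parcs G" if "(x, y) \<in> parcs G" for x y
    using that pair_sym_arcs by (auto simp: symmetric_def dest: symD)
  obtain f where f: "inj_on f P" "f ` P \<subseteq> insert v (parcs G `` {v})" "\<And>S. S \<in> P \<Longrightarrow> f S \<in> S"
    using domatic_partition_transversal[OF assms(1) v] by blast
  have "v \<notin> parcs G `` {v}"
    using pair_no_loops by fastforce
  then have "card (insert v (parcs G `` {v})) = card P"
    using card_P finite_neighbours by simp
  \<comment> \<open>An injection into a finite set of the same size is onto.\<close>
  then have f_image: "f ` P = insert v (parcs G `` {v})"
    using f(1,2) finite_neighbours by (intro card_subset_eq) (auto simp: card_image)
  have fin_P: "finite P"
    using finite_elements[OF pair_finite_verts part] .
  \<comment> \<open>\<open>Theta_construction\<close> indexes its graphs by \<open>{1..r}\<close>,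
    so the classes are numbered, with \<open>r = card P\<close>.\<close>
  obtain h where h: "bij_betw h {1..card P} P"
    using ex_bij_betw_nat_finite_1[OF fin_P] by blast
  have h_in: "h t \<in> P" if "t \<in> {1..card P}" for t
    using h that by (auto simp: bij_betw_def)
  have h_disj: "t = t'" if "t \<in> {1..card P}" "t' \<in> {1..card P}" "x \<in> h t" "x \<in> h t'" for t t' x
    using disj[OF h_in[OF that(1)] h_in[OF that(2)] that(3,4)] that(1,2) bij_betw_imp_inj_on[OF h]
    by (blast dest: inj_onD)
  have verts: "(\<Union>t\<in>{1..card P}. h t) = pverts G"
    using h partition_onD1[OF part] by (simp add: bij_betw_def)
  obtain i where i: "i \<in> {1..card P}" "v \<in> h i"
    using v verts by blast
  \<comment> \<open>Since \<open>f\<close> is onto, some class has representative \<open>v\<close>,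
    and only \<open>h i\<close> contains \<open>v\<close>.\<close>
  have f_hi: "f (h i) = v"
  proof -
    have "v \<in> f ` P" unfolding f_image by simp
    then obtain S where S: "S \<in> P" "f S = v" by blast
    then have "v \<in> S" using f(3) by blast
    then have "S = h i" using disj[OF S(1) h_in[OF i(1)]] i(2) by blast
    then show ?thesis using S(2) by simp
  qed
  \<comment> \<open>Dropping \<open>v\<close> from the closed neighbourhood leaves the
    representatives of the other classes; these become the vertices \<open>w j\<close>.\<close>
  have nbrs: "parcs G `` {v} = (\<lambda>j. f (h j)) ` ({1..card P} - {i})"
  proof -
    have "parcs G `` {v} = f ` P - {f (h i)}"
      using f_image f_hi \<open>v \<notin> parcs G `` {v}\<close> by blast
    also have "\<dots> = f ` (P - {h i})"
      using f(1) h_in[OF i(1)] by (auto dest: inj_onD)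
    also have "P - {h i} = h ` ({1..card P} - {i})"
      using h i(1) by (auto simp: bij_betw_def dest: inj_onD)
    finally show ?thesis by (simp add: image_image)
  qed
  have nbrs_iff: "(v, x) \<in> parcs G \<longleftrightarrow> (\<exists>j\<in>{1..card P} - {i}. x = f (h j))" for x
    using nbrs by auto
  define H where "H t = \<lparr>pverts = h t, parcs = parcs G \<inter> h t \<times> h t\<rparr>" for t
  \<comment> \<open>\<open>F\<close> takes all arcs away from \<open>v\<close>, also those inside a
    class; the overlap with the arcs of \<open>H t\<close> is harmless in a union.\<close>
  define F where "F = {(x, y) \<in> parcs G. x \<noteq> v \<and> y \<noteq> v}"
  have H_sub: "h t \<subseteq> pverts G" if "t \<in> {1..card P}" for t
    using verts that by blast
  \<comment> \<open>Every neighbour of \<open>v\<close> represents a class other than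
    \<open>h i\<close>, hence lies outside \<open>h i\<close>.\<close>
  have isolated: "(v, x) \<notin> parcs G" if "x \<in> h i" for x
  proof
    assume "(v, x) \<in> parcs G"
    then obtain j where j: "j \<in> {1..card P}" "j \<noteq> i" "x = f (h j)"
      using nbrs_iff[of x] by blast
    then have "x \<in> h j" using f(3) h_in by blast
    then show False
      using h_disj[OF j(1) i(1) _ that] j(2) by blast
  qed
  have H_graph: "pair_graph (H t)" if "t \<in> {1..card P}" for t
  proof
    show "finite (pverts (H t))"
      using finite_subset[OF H_sub[OF that] pair_finite_verts] by (simp add: H_def)
    show "finite (parcs (H t))"
      using pair_finite_arcs by (simp add: H_def)
    show "symmetric (with_proj (H t))"
      using arc_sym by (auto simp: H_def symmetric_def sym_def)
  qed (use pair_no_loops in \<open>auto simp: H_def\<close>)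
  have "Theta_construction (card P) H i v (\<lambda>j. f (h j)) F G"
    unfolding Theta_construction_def
  proof (intro conjI ballI impI)
    fix t assume t: "t \<in> {1..card P}"
    show "pair_graph (H t)" using H_graph[OF t] .
    show "pverts (H t) \<noteq> {}"
      using f(3)[OF h_in[OF t]] by (auto simp: H_def)
  next
    show "disjoint_family_on (\<lambda>t. pverts (H t)) {1..card P}"
      using h_disj by (auto simp: disjoint_family_on_def H_def simp del: atLeastAtMost_iff)
  next
    show "i \<in> {1..card P}" by fact
  next
    show "isolated_vertex (H i) v"
      using i isolated by (auto simp: isolated_vertex_def H_def)
  next
    fix j assume "j \<in> {1..card P} - {i}"
    then show "f (h j) \<in> pverts (H j)" using f(3) h_in by (simp add: H_def)
  next
    show "F \<subseteq> ((\<Union>t\<in>{1..card P}. pverts (H t)) - {v}) \<times> ((\<Union>t\<in>{1..card P}. pverts (H t)) - {v})"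
      using verts in_arcsD1 in_arcsD2 by (auto simp: F_def H_def)
  next
    show "sym F" using arc_sym by (auto simp: F_def sym_def)
    show "irrefl F" using pair_no_loops by (fastforce simp: F_def irrefl_def)
  next
    let ?A = "(\<Union>t\<in>{1..card P}. parcs (H t))
      \<union> (\<Union>j\<in>{1..card P} - {i}. {(v, f (h j)), (f (h j), v)}) \<union> F"
    have "(x, y) \<in> parcs G \<longleftrightarrow> (x, y) \<in> ?A" for x y
    proof
      assume xy: "(x, y) \<in> parcs G"
      \<comment> \<open>Arcs at \<open>v\<close> are the joins to the representatives; all remaining
        arcs are in \<open>F\<close>.\<close>
      consider "x = v" | "y = v" | "x \<noteq> v" "y \<noteq> v" by blast
      then show "(x, y) \<in> ?A"
      proof cases
        case 1
        then show ?thesis using xy nbrs_iff[of y] by auto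
      next
        case 2
        then show ?thesis using arc_sym[OF xy] nbrs_iff[of x] by auto
      next
        case 3
        then show ?thesis using xy by (simp add: F_def)
      qed
    next
      assume "(x, y) \<in> ?A"
      then show "(x, y) \<in> parcs G"
        using nbrs_iff arc_sym by (auto simp: H_def F_def)
    qed
    then have "parcs G = ?A" by auto
    then show "G = \<lparr>pverts = (\<Union>t\<in>{1..card P}. pverts (H t)), parcs = ?A\<rparr>"
      using verts by (simp add: H_def)
  next
    fix t t' x
    assume t: "t \<in> {1..card P}" "t' \<in> {1..card P}" "t \<noteq> t'" and x: "x \<in> pverts (H t)"
    then have "x \<notin> h t'"
      using h_disj[OF t(1,2)] by (auto simp: H_def)
    moreover have "x \<in> pverts G"
      using x H_sub t(1) by (auto simp: H_def)
    ultimately show "\<exists>y\<in>pverts (H t'). (x, y) \<in> parcs G"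
      using dom[OF h_in[OF t(2)]] by (auto simp: dominating_set_def H_def)
  qed
  then show ?thesis unfolding Theta_def by blast
qed

text \<open>The last clause of the construction makes each vertex set dominating. Disjoint nonempty
  sets are distinct, so passing from the indexed family to a set of sets loses no class.\<close>

lemma Theta_construction_domatic_partition:
  assumes "Theta_construction r H i v w F G"
  shows "domatic_partition G ((\<lambda>t. pverts (H t)) ` {1..r})"
    and "card ((\<lambda>t. pverts (H t)) ` {1..r}) = r"
proof -
  have ne: "\<And>t. t \<in> {1..r} \<Longrightarrow> pverts (H t) \<noteq> {}"
    and disj: "disjoint_family_on (\<lambda>t. pverts (H t)) {1..r}"
    and verts: "pverts G = (\<Union>t\<in>{1..r}. pverts (H t))"
    and nbr: "\<And>t t' x. t \<in> {1..r} \<Longrightarrow> t' \<in> {1..r} \<Longrightarrow> t \<noteq> t' \<Longrightarrow> x \<in> pverts (H t) \<Longrightarrow>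
      \<exists>y\<in>pverts (H t'). (x, y) \<in> parcs G"
    using assms unfolding Theta_construction_def by (blast, blast, simp, blast)
  have "partition_on (pverts G) ((\<lambda>t. pverts (H t)) ` {1..r})"
    unfolding partition_on_def
    using ne disjoint_family_on_disjoint_image[OF disj] verts by fastforce
  moreover have "dominating_set G (pverts (H t))" if "t \<in> {1..r}" for t
    unfolding dominating_set_def verts using nbr[OF _ that] that by blast
  ultimately show "domatic_partition G ((\<lambda>t. pverts (H t)) ` {1..r})"
    by (auto simp: domatic_partition_def)
  have "inj_on (\<lambda>t. pverts (H t)) {1..r}"
    using disj ne unfolding disjoint_family_on_def inj_on_def by (metis inf.idem)
  then show "card ((\<lambda>t. pverts (H t)) ` {1..r}) = r"
    by (simp add: card_image)
qed

text \<open>No \<open>H t\<close> has an arc leaving \<open>v\<close>: it is isolated in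
  \<open>H i\<close> and absent from the others. Since \<open>F\<close> avoids \<open>v\<close> too,
  only the \<open>r - 1\<close> joins contribute neighbours.\<close>

lemma Theta_construction_degree:
  assumes "Theta_construction r H i v w F G"
  shows "v \<in> pverts G" and "card (parcs G `` {v}) \<le> r - 1"
proof -
  have graph: "\<And>t. t \<in> {1..r} \<Longrightarrow> pair_graph (H t)"
    and disj: "disjoint_family_on (\<lambda>t. pverts (H t)) {1..r}"
    and i: "i \<in> {1..r}" and iso: "isolated_vertex (H i) v"
    and F: "F \<subseteq> (UNIV - {v}) \<times> UNIV"
    and verts: "pverts G = (\<Union>t\<in>{1..r}. pverts (H t))"
    and arcs: "parcs G = (\<Union>t\<in>{1..r}. parcs (H t))
      \<union> (\<Union>j\<in>{1..r} - {i}. {(v, w j), (w j, v)}) \<union> F"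
    and w: "\<And>j. j \<in> {1..r} - {i} \<Longrightarrow> w j \<in> pverts (H j)"
    using assms unfolding Theta_construction_def by (blast, blast, blast, blast, blast, simp, simp, blast)
  have v_i: "v \<in> pverts (H i)" using iso by (simp add: isolated_vertex_def)
  then show "v \<in> pverts G" using i verts by blast
  have only_i: "t = i" if "t \<in> {1..r}" "v \<in> pverts (H t)" for t
    using disj that i v_i unfolding disjoint_family_on_def by blast
  have "(v, x) \<notin> parcs (H t)" if t: "t \<in> {1..r}" for t x
  proof
    interpret Ht: pair_graph "H t" using graph[OF t] .
    assume "(v, x) \<in> parcs (H t)"
    then show False
      using Ht.in_arcsD1 Ht.in_arcsD2 only_i[OF t] iso by (auto simp: isolated_vertex_def)
  qed
  \<comment> \<open>This keeps the reversed joins \<open>(w j, v)\<close> from starting at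
    \<open>v\<close>.\<close>
  moreover have "w j \<noteq> v" if "j \<in> {1..r} - {i}" for j
    using w[OF that] only_i that by blast
  ultimately have "parcs G `` {v} \<subseteq> w ` ({1..r} - {i})"
    using F unfolding arcs by blast
  then have "card (parcs G `` {v}) \<le> card ({1..r} - {i})"
    using surj_card_le[of "{1..r} - {i}"] by blast
  then show "card (parcs G `` {v}) \<le> r - 1"
    using i by simp
qed

theorem theorem8:
  fixes G :: "'a pair_pre_digraph"
  assumes "pair_graph G" and "pverts G \<noteq> {}"
  shows "full_graph G \<longleftrightarrow> G \<in> Theta"
proof -
  interpret pair_graph G by fact
  show ?thesis
  proof
    assume "full_graph G"
    then obtain P where "domatic_partition G P" "card P = min_degree G + 1"
      using full_graph_iff[OF assms(2)] by blast
    moreover obtain v where "v \<in> pverts G" "card (parcs G `` {v}) = min_degree G"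
      using min_degree_attained[OF assms(2)] .
    ultimately show "G \<in> Theta"
      using domatic_partition_card_Suc_degree_imp_Theta by metis
  next
    assume "G \<in> Theta"
    then obtain r H i v w F where T: "Theta_construction r H i v w F G"
      unfolding Theta_def by blast
    note P = Theta_construction_domatic_partition[OF T]
    \<comment> \<open>Subtraction on naturals truncates, so \<open>r - 1\<close> needs this. The
      degree of \<open>v\<close> and the partition into \<open>r\<close> classes then bound
      \<open>min_degree G\<close> from above and below.\<close>
    have "r \<ge> 1"
      using T unfolding Theta_construction_def by auto
    moreover have "min_degree G \<le> r - 1"
      using min_degree_le Theta_construction_degree[OF T] le_trans by blast
    moreover have "r \<le> min_degree G + 1"
      using card_domatic_partition_le_min_degree[OF assms(2) P(1)] P(2) by simp
    ultimately have "r = min_degree G + 1" by linarith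
    then show "full_graph G"
      using P full_graph_iff[OF assms(2)] by metis
  qed
qed

end
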